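(* Let $c(n,3)$, $n\ge 0$, be defined by $(1-9x)^{-1/3}=\sum_{n\ge 0}c(n,3)x^n$. Let $p\ne 3$ be a prime and write $n=a_0+a_1p+\cdots+a_dp^d$ in base $p$ (digits $0\le a_j\le p-1$). Then $p$ does not divide $c(n,3)$ if and only if for every $j$ with $0\le j\le d$, $$a_j<\begin{cases} p/3 & \text{if } j \text{ is odd or } p\equiv 1 \pmod 3,\\ 2p/3 & \text{otherwise.}\end{cases}$$ *)

theory Defs
  imports Complex_Main
    "HOL-Computational_Algebra.Computational_Algebra"
    "HOL-Number_Theory.Number_Theory"
begin

text \<open>
  The series of \<open>(1 - 9 * x) powr (- 1 / 3)\<close>: \<open>fps_binomial a\<close> is the series of
  \<open>(1 + y) powr a\<close>, composed here with \<open>y = - 9 * x\<close>.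
\<close>

definition c3_series :: "rat fps" where
  "c3_series = fps_compose (fps_binomial (- 1 / 3)) (fps_const (- 9) * fps_X)"

text \<open>
  The coefficients of \<open>c3_series\<close> are integers (lemma \<open>of_int_c3\<close> below), so taking the
  floor only changes the type and \<open>dvd\<close> is divisibility of integers.
\<close>

definition c3 :: "nat \<Rightarrow> int" where
  "c3 n = \<lfloor>fps_nth c3_series n\<rfloor>"

lemma c3_series_cube: "c3_series ^ 3 * (1 - fps_const 9 * fps_X) = 1"
proof -
  have z: "fps_nth (fps_const (- 9) * fps_X :: rat fps) 0 = 0" by simp
  have "c3_series ^ 3 = fps_compose (fps_binomial (- 1)) (fps_const (- 9) * fps_X)"
    unfolding c3_series_def fps_compose_power[OF z] fps_binomial_power by simp
  moreover have "1 - fps_const 9 * fps_X =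
      fps_compose (fps_binomial (1 :: rat)) (fps_const (- 9) * fps_X)"
    unfolding fps_binomial_1 fps_compose_add_distrib
    by (simp add: fps_const_neg [symmetric] del: fps_const_neg)
  ultimately show ?thesis
    by (simp add: fps_compose_mult_distrib[OF z, symmetric] fps_binomial_add_mult[symmetric])
qed

lemma c3_series_Ints: "fps_nth c3_series n \<in> \<int>"
proof -
  define G where "G = fps_const (1 / 3) * (c3_series - 1)"
  have F: "c3_series = 1 + fps_const 3 * G"
    by (simp add: G_def mult.assoc[symmetric])
  have G0: "fps_nth G 0 = 0"
    by (simp add: G_def c3_series_def)
  define H where "H = G + 3 * G ^ 2 + 3 * G ^ 3"
  have "(1 + 3 * G) ^ 3 * (1 - 9 * fps_X) = 1"
    using c3_series_cube unfolding F by (simp add: numeral_fps_const)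
  moreover have "9 * (H * (1 - 9 * fps_X) - fps_X) = (1 + 3 * G) ^ 3 * (1 - 9 * fps_X) - 1"
    unfolding H_def by (simp add: power3_eq_cube power2_eq_square algebra_simps)
  ultimately have "9 * (H * (1 - 9 * fps_X) - fps_X) = 0"
    by simp
  hence "H * (1 - 9 * fps_X) - fps_X = 0"
    by (simp only: mult_eq_0_iff) simp
  hence eq: "H = fps_X + 9 * (fps_X * H)"
    by (simp add: right_diff_distrib diff_eq_eq mult_ac)
  have "fps_nth G n \<in> \<int>" for n
  proof (induction n rule: less_induct)
    case (less n)
    have sq: "fps_nth (G ^ 2) m \<in> \<int>" if "m \<le> n" for m
    proof -
      have "fps_nth G i * fps_nth G (m - i) \<in> \<int>" if "i \<le> m" for i
        using less G0 \<open>m \<le> n\<close> that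
        by (cases "i = 0"; cases "i = m") (auto intro!: Ints_mult)
      thus ?thesis
        by (auto simp: power2_eq_square fps_mult_nth intro!: Ints_sum)
    qed
    have cb: "fps_nth (G ^ 3) m \<in> \<int>" if "m \<le> n" for m
    proof -
      have sq0: "fps_nth (G ^ 2) 0 = 0" using G0 by simp
      have "fps_nth G i * fps_nth (G ^ 2) (m - i) \<in> \<int>" if "i \<le> m" for i
      proof (cases "i = m")
        case True
        show ?thesis by (simp only: True diff_self_eq_0 sq0) simp
      next
        case False
        with that \<open>m \<le> n\<close> less[of i] sq[of "m - i"] show ?thesis
          by (intro Ints_mult) auto
      qed
      moreover have "G ^ 3 = G * G ^ 2" by (simp add: power3_eq_cube power2_eq_square)
      ultimately show ?thesis
        by (auto simp: fps_mult_nth intro!: Ints_sum)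
    qed
    have HI: "fps_nth H m \<in> \<int>" if "m < n" for m
      unfolding H_def using less[of m] sq[of m] cb[of m] that
      by (auto simp: numeral_fps_const intro!: Ints_add Ints_mult)
    have "fps_nth H n \<in> \<int>"
      by (subst eq) (use HI[of "n - 1"] in \<open>auto simp: numeral_fps_const intro!: Ints_add Ints_mult\<close>)
    moreover have "fps_nth G n = fps_nth H n - 3 * fps_nth (G ^ 2) n - 3 * fps_nth (G ^ 3) n"
      by (simp add: H_def numeral_fps_const)
    ultimately show ?case
      using sq[of n] cb[of n] by (auto intro!: Ints_diff Ints_mult)
  qed
  thus ?thesis
    unfolding F by (auto intro!: Ints_add Ints_mult)
qed

lemma of_int_c3: "of_int (c3 n) = fps_nth c3_series n"
  using c3_series_Ints[of n] by (auto simp: c3_def elim: Ints_cases)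

end

theory Submission
  imports Defs
begin

text \<open>
  Since \<open>c3 n * n! = 3 ^ n * (1 * 4 * \<dots> * (3 * n - 2))\<close>, one compares the \<open>p\<close>-adic valuations
  of two products over arithmetic progressions. The multiples of \<open>p\<close> in the progression
  \<open>3 * k + r\<close> (\<open>r = 1, 2\<close>) are \<open>p\<close> times the terms of the progression \<open>3 * k + r'\<close>, where
  \<open>p * r' \<equiv> r\<close> modulo 3; the first of them has index \<open>s = (p * r' - r) / 3 < p\<close>. Splitting off
  the last digit \<open>b\<close> of \<open>n = p * m + b\<close> therefore contributes the same valuation \<open>m\<close> to both
  products, except for one further multiple of \<open>p\<close> in the numerator when \<open>b > s\<close>, and it
  replaces \<open>n, r\<close> by \<open>m, r'\<close>. The residue \<open>r'\<close> alternates with the digit position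
  precisely when \<open>p \<equiv> 2\<close> modulo 3.
\<close>

text \<open>The general step \<open>q\<close> lets the factorial (\<open>q = r = 1\<close>) and the
  numerator (\<open>q = 3\<close>) share one digit lemma.\<close>

definition prog_prod :: "nat \<Rightarrow> nat \<Rightarrow> nat \<Rightarrow> nat" where
  "prog_prod q r n = (\<Prod>k<n. q * k + r)"

lemma prog_prod_pos: "r > 0 \<Longrightarrow> prog_prod q r n > 0"
  by (auto simp: prog_prod_def intro!: prod_pos)

lemma prog_prod_1_1: "prog_prod 1 1 n = fact n"
  by (induction n) (simp_all add: prog_prod_def)

lemma prog_prod_add:
  "prog_prod q r (n + b) = prog_prod q r n * prog_prod q (q * n + r) b"
  by (induction b) (simp_all add: prog_prod_def algebra_simps)

text \<open>As \<open>q\<close> is invertible modulo \<open>p\<close>, a block of \<open>p\<close>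
  consecutive indices has at most one multiple of \<open>p\<close>; the equation for
  \<open>s\<close> exhibits it.\<close>

lemma prog_dvd_iff:
  fixes p q r r' s m i :: nat
  assumes "prime p" "coprime p q" "q * s + r = p * r'" "s < p" "i < p"
  shows "p dvd q * (p * m + i) + r \<longleftrightarrow> i = s"
proof
  assume "p dvd q * (p * m + i) + r"
  hence "[q * (p * m + i) + r = q * s + r] (mod p)"
    using assms(3) by (metis cong_0_iff cong_sym cong_trans dvd_triv_left)
  hence "[q * (p * m + i) = q * s] (mod p)"
    by (simp add: cong_add_rcancel_nat)
  hence "[p * m + i = s] (mod p)"
    using assms(2) by (simp add: cong_mult_lcancel_nat coprime_commute)
  thus "i = s"
    using assms(4,5) by (simp add: cong_def)
next
  assume "i = s"
  hence "q * (p * m + i) + r = p * (q * m + r')"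
    using assms(3) by (simp add: algebra_simps)
  thus "p dvd q * (p * m + i) + r" by simp
qed

text \<open>Only the term of index \<open>p * m + s\<close> contributes, and it equals
  \<open>p * (q * m + r')\<close>. The case \<open>b = p\<close> is kept for full blocks.\<close>

lemma multiplicity_prog_block:
  fixes p q r r' s m b :: nat
  assumes "prime p" "coprime p q" "r > 0" "r' > 0" "q * s + r = p * r'" "s < p" "b \<le> p"
  shows "multiplicity p (prog_prod q (q * (p * m) + r) b) =
    (if b \<le> s then 0 else Suc (multiplicity p (q * m + r')))"
  using \<open>b \<le> p\<close>
proof (induction b)
  case 0
  thus ?case by (simp add: prog_prod_def)
next
  case (Suc b)
  have step: "prog_prod q (q * (p * m) + r) (Suc b) =
      prog_prod q (q * (p * m) + r) b * (q * (p * m + b) + r)"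
    by (simp add: prog_prod_def algebra_simps)
  have mult: "multiplicity p (prog_prod q (q * (p * m) + r) (Suc b)) =
      multiplicity p (prog_prod q (q * (p * m) + r) b) + multiplicity p (q * (p * m + b) + r)"
    unfolding step using assms(1,3) prog_prod_pos[of "q * (p * m) + r" q b]
    by (intro prime_elem_multiplicity_mult_distrib) auto
  have dvd: "p dvd q * (p * m + b) + r \<longleftrightarrow> b = s"
    using assms Suc.prems by (intro prog_dvd_iff) auto
  show ?case
  proof (cases "b = s")
    case True
    have "q * (p * m + b) + r = p * (q * m + r')"
      using assms(5) True by (simp add: algebra_simps)
    moreover have "multiplicity p (p * (q * m + r')) = Suc (multiplicity p (q * m + r'))"
      using assms(1,4) by (intro multiplicity_times_same) auto
    ultimately show ?thesis
      using Suc mult True by simp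
  next
    case False
    hence "multiplicity p (q * (p * m + b) + r) = 0"
      using dvd by (intro not_dvd_imp_multiplicity_0) simp
    thus ?thesis
      using Suc mult False by auto
  qed
qed

lemma multiplicity_prog_prod:
  fixes p q r r' s m b :: nat
  assumes "prime p" "coprime p q" "r > 0" "r' > 0" "q * s + r = p * r'" "s < p" "b \<le> p"
  shows "multiplicity p (prog_prod q r (p * m + b)) = m + multiplicity p (prog_prod q r' m) +
    (if b \<le> s then 0 else Suc (multiplicity p (q * m + r')))"
proof -
  have split: "multiplicity p (prog_prod q r (p * m + b)) = multiplicity p (prog_prod q r (p * m)) +
      (if b \<le> s then 0 else Suc (multiplicity p (q * m + r')))" if "b \<le> p" for m b
    unfolding prog_prod_add multiplicity_prog_block[OF assms(1-6) that, symmetric]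
    using assms(1,3) prog_prod_pos[of r q "p * m"] prog_prod_pos[of "q * (p * m) + r" q b]
    by (intro prime_elem_multiplicity_mult_distrib) auto
  have "multiplicity p (prog_prod q r (p * m)) = m + multiplicity p (prog_prod q r' m)"
  proof (induction m)
    case 0
    thus ?case by (simp add: prog_prod_def)
  next
    case (Suc m)
    have "multiplicity p (prog_prod q r' (Suc m)) =
        multiplicity p (prog_prod q r' m) + multiplicity p (q * m + r')"
      unfolding prog_prod_def prod.lessThan_Suc
      using assms(1,4) prog_prod_pos[of r' q m, unfolded prog_prod_def]
      by (intro prime_elem_multiplicity_mult_distrib) auto
    moreover have "p * Suc m = p * m + p" by simp
    ultimately show ?case
      \<comment> \<open>A full block always reaches index \<open>s\<close>, since
        \<open>s < p\<close>; it adds 1 and the valuation of the next term of the \<open>r'\<close>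
        progression.\<close>
      using split[of p m] Suc assms(6) by (simp add: add.commute)
  qed
  thus ?thesis using split[OF assms(7)] by simp
qed

text \<open>Here \<open>s = p - 1\<close>, so a digit \<open>b < p\<close> never produces an extra
  multiple of \<open>p\<close>.\<close>

lemma multiplicity_fact_digit:
  fixes p m b :: nat
  assumes "prime p" "b < p"
  shows "multiplicity p (fact (p * m + b) :: nat) = m + multiplicity p (fact m :: nat)"
  using multiplicity_prog_prod[of p 1 1 1 "p - 1" b m] assms prime_gt_0_nat[of p]
  by (simp add: prog_prod_1_1[unfolded One_nat_def])

text \<open>For a prime \<open>p\<close> other than 3 and \<open>r\<close> in {1, 2}, this is
  \<open>r\<close> divided by \<open>p ^ (j + 1)\<close> modulo 3, the residue reached once digits 0
  to \<open>j\<close> are removed.\<close>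

definition digit_residue :: "nat \<Rightarrow> nat \<Rightarrow> nat \<Rightarrow> nat" where
  "digit_residue p r j = (if odd j \<or> [p = 1] (mod 3) then r else 3 - r)"

text \<open>The bound on \<open>r\<close> makes the truncated \<open>3 - (3 - r)\<close> equal to
  \<open>r\<close>.\<close>

lemma digit_residue_Suc:
  "r \<le> 3 \<Longrightarrow> digit_residue p r (Suc j) = digit_residue p (digit_residue p r 0) j"
  by (auto simp: digit_residue_def)

lemma multiplicity_prog3_digit:
  fixes p r m b :: nat
  assumes "prime p" "p \<noteq> 3" "r \<in> {1, 2}" "b < p"
  defines "r' \<equiv> digit_residue p r 0"
  shows "multiplicity p (prog_prod 3 r (p * m + b)) = m + multiplicity p (prog_prod 3 r' m) +
    (if 3 * b < p * r' then 0 else Suc (multiplicity p (3 * m + r')))"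
proof -
  have cop: "coprime p 3"
    using assms(1,2) by (intro primes_coprime) simp_all
  have "\<not> 3 dvd p"
    using assms(1,2) primes_dvd_imp_eq[of 3 p] by auto
  hence p3: "p mod 3 = 1 \<or> p mod 3 = 2" by presburger
  have r': "r' \<in> {1, 2}"
    using assms(3) by (auto simp: r'_def digit_residue_def)
  have cong: "p * r' mod 3 = r"
    using assms(3) p3
    by (subst mod_mult_left_eq [symmetric])
       (auto simp: r'_def digit_residue_def cong_def)
  define s where "s = p * r' div 3"
  have s: "3 * s + r = p * r'"
    using mult_div_mod_eq[of 3 "p * r'"] cong by (simp add: s_def)
  have "p * r' \<le> 2 * p" using r' by auto
  hence "s < p" using s assms(3) prime_gt_0_nat[OF assms(1)] by linarith
  \<comment> \<open>Since \<open>0 < r < 3\<close>, the integer bound by \<open>s\<close> is the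
    same as the bound by \<open>p * r' / 3\<close>.\<close>
  moreover have "b \<le> s \<longleftrightarrow> 3 * b < p * r'"
    unfolding s[symmetric] using assms(3) by auto
  ultimately show ?thesis
    using multiplicity_prog_prod[OF assms(1) cop _ _ s, of b m] assms(3,4) r' by auto
qed

text \<open>Induction removes the lowest digit, which changes \<open>r\<close>. The inequality is
  carried along because it keeps the positive surplus of a bad digit from being cancelled by the
  remaining digits.\<close>

lemma multiplicity_prog3_fact:
  fixes p r d :: nat and a :: "nat \<Rightarrow> nat"
  assumes "prime p" "p \<noteq> 3" "r \<in> {1, 2}" "\<And>j. j \<le> d \<Longrightarrow> a j < p"
  defines "n \<equiv> \<Sum>j\<le>d. a j * p ^ j"
  shows "multiplicity p (fact n :: nat) \<le> multiplicity p (prog_prod 3 r n) \<and>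
    (multiplicity p (prog_prod 3 r n) = multiplicity p (fact n :: nat) \<longleftrightarrow>
      (\<forall>j\<le>d. 3 * a j < p * digit_residue p r j))"
  using assms(3,4) unfolding n_def
proof (induction d arbitrary: r a)
  case 0
  thus ?case
    using multiplicity_prog3_digit[OF assms(1,2), of r "a 0" 0]
      multiplicity_fact_digit[OF assms(1), of "a 0" 0]
    by (auto simp: prog_prod_def)
next
  case (Suc d)
  define r' where "r' = digit_residue p r 0"
  define m where "m = (\<Sum>j\<le>d. a (Suc j) * p ^ j)"
  have n: "(\<Sum>j\<le>Suc d. a j * p ^ j) = p * m + a 0"
    by (simp add: sum.atMost_Suc_shift m_def sum_distrib_left mult_ac del: sum.atMost_Suc)
  have r': "r' \<in> {1, 2}"
    using Suc.prems(1) by (auto simp: r'_def digit_residue_def)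
  have IH: "multiplicity p (fact m :: nat) \<le> multiplicity p (prog_prod 3 r' m) \<and>
    (multiplicity p (prog_prod 3 r' m) = multiplicity p (fact m :: nat) \<longleftrightarrow>
      (\<forall>j\<le>d. 3 * a (Suc j) < p * digit_residue p r' j))"
    unfolding m_def by (rule Suc.IH[OF r']) (use Suc.prems(2) in auto)
  have all: "(\<forall>j\<le>Suc d. 3 * a j < p * digit_residue p r j) \<longleftrightarrow>
      3 * a 0 < p * r' \<and> (\<forall>j\<le>d. 3 * a (Suc j) < p * digit_residue p r' j)"
    using Suc.prems(1) digit_residue_Suc[of r p] unfolding r'_def
    by (subst all_simps[symmetric], subst less_Suc_eq_le[symmetric], subst All_less_Suc2)
       (auto simp: less_Suc_eq_le)
  show ?case
    unfolding n all
    using IH Suc.prems multiplicity_prog3_digit[OF assms(1,2), of r "a 0" m, folded r'_def]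
      multiplicity_fact_digit[OF assms(1), of "a 0" m]
    by auto
qed

lemma c3_mult_fact: "c3 n * fact n = 3 ^ n * int (prog_prod 3 1 n)"
proof -
  have "rat_of_int (c3 n) * fact n = (- 9) ^ n * ((- 1 / 3 gchoose n) * fact n)"
    unfolding of_int_c3 c3_series_def fps_compose_linear by simp
  also have "(- 1 / 3 gchoose n) * fact n = (\<Prod>k<n. - 1 / 3 - of_nat k :: rat)"
    by (simp add: gbinomial_prod_rev atLeast0LessThan)
  \<comment> \<open>Each factor \<open>- 9\<close> is paired with one factor of the falling product,
    giving \<open>3 * (3 * k + 1)\<close>.\<close>
  also have "(- 9) ^ n * \<dots> = (\<Prod>k<n. (- 9) * (- 1 / 3 - of_nat k :: rat))"
    by (simp only: prod.distrib) simp
  also have "\<dots> = (\<Prod>k<n. 3 * of_nat (3 * k + 1))"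
    by (intro prod.cong) (simp_all add: algebra_simps)
  also have "\<dots> = rat_of_int (3 ^ n * int (prog_prod 3 1 n))"
    unfolding prod.distrib by (simp add: prog_prod_def add.commute)
  finally have "rat_of_int (c3 n * fact n) = rat_of_int (3 ^ n * int (prog_prod 3 1 n))"
    by simp
  thus ?thesis by (simp only: of_int_eq_iff)
qed

text \<open>For \<open>p\<close> other than 3 the power of 3 has valuation 0, so the valuation of
  \<open>c3 n\<close> is the difference of the other two.\<close>

lemma not_dvd_c3_iff:
  assumes "prime p" "p \<noteq> 3"
  shows "\<not> int p dvd c3 n \<longleftrightarrow>
    multiplicity p (prog_prod 3 1 n) = multiplicity p (fact n :: nat)"
proof -
  have pos: "0 < c3 n * fact n"
    unfolding c3_mult_fact using prog_prod_pos[of 1 3 n] by simp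
  define c where "c = nat (c3 n)"
  have c: "c3 n = int c" "c > 0"
    using pos by (auto simp: c_def zero_less_mult_iff)
  have "c * fact n = 3 ^ n * prog_prod 3 1 n"
    using c3_mult_fact[of n] unfolding c
    by (simp flip: of_nat_eq_iff[where 'a = int])
  hence "multiplicity p (c * fact n) = multiplicity p (3 ^ n * prog_prod 3 1 n)"
    by simp
  moreover have "multiplicity p (c * fact n) = multiplicity p c + multiplicity p (fact n :: nat)"
    using assms(1) c by (intro prime_elem_multiplicity_mult_distrib) auto
  moreover have "multiplicity p (3 ^ n * prog_prod 3 1 n) =
      multiplicity p (3 ^ n) + multiplicity p (prog_prod 3 1 n)"
    using assms(1) prog_prod_pos[of 1 3 n] by (intro prime_elem_multiplicity_mult_distrib) auto
  moreover have "multiplicity p (3 ^ n :: nat) = 0"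
    using assms prime_dvd_power[of p 3 n] primes_dvd_imp_eq[of p 3]
    by (intro not_dvd_imp_multiplicity_0) auto
  moreover have "int p dvd c3 n \<longleftrightarrow> multiplicity p c \<noteq> 0"
    using assms(1) c prime_multiplicity_gt_zero_iff[of p c] by auto
  ultimately show ?thesis by auto
qed

theorem theorem3p5:
  fixes p n d :: nat and a :: "nat \<Rightarrow> nat"
  assumes "prime p" and "p \<noteq> 3"
    and "\<And>j. j \<le> d \<Longrightarrow> a j \<le> p - 1"
    and "n = (\<Sum>j\<le>d. a j * p ^ j)"
  shows "\<not> int p dvd c3 n \<longleftrightarrow>
    (\<forall>j\<le>d. real (a j) < (if odd j \<or> [p = 1] (mod 3) then real p / 3 else 2 * real p / 3))"
proof -
  have lt: "a j < p" if "j \<le> d" for j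
    using assms(3)[OF that] prime_gt_0_nat[OF assms(1)] by linarith
  \<comment> \<open>For \<open>r = 1\<close> the residue is 1 or \<open>3 - 1 = 2\<close>, which
    gives the two thresholds.\<close>
  have "real (a j) < (if odd j \<or> [p = 1] (mod 3) then real p / 3 else 2 * real p / 3) \<longleftrightarrow>
      3 * a j < p * digit_residue p 1 j" for j
    by (auto simp: digit_residue_def)
  thus ?thesis
    using multiplicity_prog3_fact[OF assms(1,2) _ lt, of 1 d]
    unfolding not_dvd_c3_iff[OF assms(1,2)] assms(4) by simp
qed

end
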